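(* The class of $(\dot\cup,\emptyset)$-representable partial algebras, viewed as a class of $\mathcal L(J,0)$-structures, is not finitely axiomatisable in first-order logic.
   Context: For sets $S,T$, the disjoint union $S\mathbin{\dot\cup}T$ equals $S\cup T$ if $S\cap T=\emptyset$, and is undefined otherwise. A partial $(\dot\cup,\emptyset)$-algebra of sets is a subset of $\wp(X)$, for some set $X$, containing $\emptyset$ and closed under $\dot\cup$ wherever it is defined. A partial $(\dot\sqcup,0)$-algebra is a set with a partial binary operation $\dot\sqcup$ and a constant $0$. It is $(\dot\cup,\emptyset)$-representable if it is isomorphic to a partial $(\dot\cup,\emptyset)$-algebra of sets, i.e. there is a bijection $\theta$ onto such an algebra of sets with $0^\theta=\emptyset$, such that $a\mathbin{\dot\sqcup}b$ is defined if and only if $a^\theta\mathbin{\dot\cup}b^\theta$ is defined, and then $(a\mathbin{\dot\sqcup}b)^\theta=a^\theta\mathbin{\dot\cup}b^\theta$. Partial $(\dot\sqcup,0)$-algebras are viewed as structures for the first-order language $\mathcal L(J,0)$ (with equality), where $J$ is a ternary relation symbol and $J(a,b,c)$ holds iff $a\mathbin{\dot\sqcup}b$ is defined and equal to $c$. *)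

theory Defs
  imports Main
begin

section \<open>Partial algebras and their representations by sets\<close>

definition disjoint_union :: "'x set \<Rightarrow> 'x set \<Rightarrow> 'x set option" where
  "disjoint_union S T = (if S \<inter> T = {} then Some (S \<union> T) else None)"

definition partial_set_algebra :: "'x set \<Rightarrow> 'x set set \<Rightarrow> bool" where
  "partial_set_algebra X F \<longleftrightarrow>
     F \<subseteq> Pow X \<and> {} \<in> F \<and>
     (\<forall>S\<in>F. \<forall>T\<in>F. \<forall>U. disjoint_union S T = Some U \<longrightarrow> U \<in> F)"

text \<open>The value \<open>None\<close> of the operation means ``undefined''; values of the operation at
  arguments outside the carrier are irrelevant.\<close>

record 'a palg =
  pcarrier :: "'a set"
  pjoin :: "'a \<Rightarrow> 'a \<Rightarrow> 'a option"
  pzero :: 'a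

definition partial_algebra :: "'a palg \<Rightarrow> bool" where
  "partial_algebra P \<longleftrightarrow>
     pzero P \<in> pcarrier P \<and>
     (\<forall>a\<in>pcarrier P. \<forall>b\<in>pcarrier P. \<forall>c. pjoin P a b = Some c \<longrightarrow> c \<in> pcarrier P)"

definition representation :: "'a palg \<Rightarrow> 'x set \<Rightarrow> ('a \<Rightarrow> 'x set) \<Rightarrow> bool" where
  "representation P X \<theta> \<longleftrightarrow>
     (\<exists>F. partial_set_algebra X F \<and> bij_betw \<theta> (pcarrier P) F \<and>
        \<theta> (pzero P) = {} \<and>
        (\<forall>a\<in>pcarrier P. \<forall>b\<in>pcarrier P.
           (pjoin P a b \<noteq> None \<longleftrightarrow> disjoint_union (\<theta> a) (\<theta> b) \<noteq> None) \<and>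
           (\<forall>c. pjoin P a b = Some c \<longrightarrow> disjoint_union (\<theta> a) (\<theta> b) = Some (\<theta> c))))"

text \<open>HOL cannot quantify existentially over the type of the points of the base set, so the base
  is taken among sets of subsets of the carrier type. By the lemma \<open>representable_any_base\<close> below
  this is no restriction: a representation over a base of any type yields one of this form
  (identify points that belong to the same represented sets).\<close>

definition representable :: "'a palg \<Rightarrow> bool" where
  "representable P \<longleftrightarrow> (\<exists>(X :: 'a set set) \<theta>. representation P X \<theta>)"

lemma representable_any_base:
  fixes P :: "'a palg" and X :: "'x set"
  assumes P: "partial_algebra P" and r: "representation P X \<theta>"
  shows "representable P"
proof -
  let ?A = "pcarrier P"
  from r obtain F where F: "partial_set_algebra X F" and bij: "bij_betw \<theta> ?A F"
    and z: "\<theta> (pzero P) = {}"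
    and du: "\<forall>a\<in>?A. \<forall>b\<in>?A.
           (pjoin P a b \<noteq> None \<longleftrightarrow> disjoint_union (\<theta> a) (\<theta> b) \<noteq> None) \<and>
           (\<forall>c. pjoin P a b = Some c \<longrightarrow> disjoint_union (\<theta> a) (\<theta> b) = Some (\<theta> c))"
    unfolding representation_def by (elim exE conjE) (rule that)
  have d: "pjoin P a b \<noteq> None \<longleftrightarrow> disjoint_union (\<theta> a) (\<theta> b) \<noteq> None"
    if "a \<in> ?A" "b \<in> ?A" for a b
    using bspec[OF bspec[OF du that(1)] that(2)] by (rule conjunct1)
  have u: "disjoint_union (\<theta> a) (\<theta> b) = Some (\<theta> c)"
    if "a \<in> ?A" "b \<in> ?A" "pjoin P a b = Some c" for a b c
    using bspec[OF bspec[OF du that(1)] that(2), THEN conjunct2] that(3) by (elim allE impE)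
  define \<pi> where "\<pi> x = {a \<in> ?A. x \<in> \<theta> a}" for x
  define \<theta>' where "\<theta>' a = \<pi> ` \<theta> a" for a
  have mem: "\<pi> x \<in> \<theta>' a \<longleftrightarrow> x \<in> \<theta> a" if "a \<in> ?A" for x a
  proof
    assume "\<pi> x \<in> \<theta>' a"
    then obtain y where "\<pi> x = \<pi> y" "y \<in> \<theta> a" unfolding \<theta>'_def by blast
    then have "a \<in> \<pi> x" using that by (simp add: \<pi>_def)
    then show "x \<in> \<theta> a" by (simp add: \<pi>_def)
  next
    assume "x \<in> \<theta> a"
    then show "\<pi> x \<in> \<theta>' a" unfolding \<theta>'_def by (rule imageI)
  qed
  have inj: "inj_on \<theta>' ?A"
  proof (rule inj_onI)
    fix a b assume ab: "a \<in> ?A" "b \<in> ?A" "\<theta>' a = \<theta>' b"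
    then have "\<theta> a = \<theta> b" using mem[OF ab(1)] mem[OF ab(2)] by (intro set_eqI) metis
    then show "a = b" using bij ab(1,2) unfolding bij_betw_def by (blast dest: inj_onD)
  qed
  have disj: "\<theta>' a \<inter> \<theta>' b = {} \<longleftrightarrow> \<theta> a \<inter> \<theta> b = {}" if "a \<in> ?A" "b \<in> ?A" for a b
  proof
    assume "\<theta>' a \<inter> \<theta>' b = {}"
    then show "\<theta> a \<inter> \<theta> b = {}" using mem[OF that(1)] mem[OF that(2)] by blast
  next
    assume *: "\<theta> a \<inter> \<theta> b = {}"
    show "\<theta>' a \<inter> \<theta>' b = {}"
    proof (rule ccontr)
      assume "\<theta>' a \<inter> \<theta>' b \<noteq> {}"
      then obtain x where "x \<in> \<theta> a" "\<pi> x \<in> \<theta>' b" by (auto simp: \<theta>'_def)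
      then show False using mem[OF that(2)] * by auto
    qed
  qed
  have d': "pjoin P a b \<noteq> None \<longleftrightarrow> disjoint_union (\<theta>' a) (\<theta>' b) \<noteq> None"
    if "a \<in> ?A" "b \<in> ?A" for a b
    using d[OF that] disj[OF that] by (simp add: disjoint_union_def)
  have u': "disjoint_union (\<theta>' a) (\<theta>' b) = Some (\<theta>' c)"
    if "a \<in> ?A" "b \<in> ?A" "pjoin P a b = Some c" for a b c
  proof -
    have *: "\<theta> a \<inter> \<theta> b = {}" "\<theta> a \<union> \<theta> b = \<theta> c"
      using u[OF that] by (simp_all add: disjoint_union_def split: if_splits)
    have "\<theta>' a \<inter> \<theta>' b = {}" using disj[OF that(1,2)] *(1) by (rule iffD2)
    moreover have "\<theta>' a \<union> \<theta>' b = \<theta>' c" unfolding \<theta>'_def *(2)[symmetric] by (simp add: image_Un)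
    ultimately show ?thesis by (simp add: disjoint_union_def)
  qed
  have alg: "partial_set_algebra (\<pi> ` X) (\<theta>' ` ?A)"
    unfolding partial_set_algebra_def
  proof (intro conjI ballI allI impI)
    have "\<theta> a \<subseteq> X" if "a \<in> ?A" for a
    proof -
      have "\<theta> a \<in> F" using bij that by (rule bij_betwE[THEN bspec])
      then show ?thesis using F unfolding partial_set_algebra_def by blast
    qed
    then show "\<theta>' ` ?A \<subseteq> Pow (\<pi> ` X)" unfolding \<theta>'_def by (intro image_subsetI PowI image_mono)
    have "\<theta>' (pzero P) = {}" using z by (simp add: \<theta>'_def)
    moreover have "pzero P \<in> ?A" using P by (simp add: partial_algebra_def)
    ultimately show "{} \<in> \<theta>' ` ?A" by (metis imageI)
    fix S T U assume "S \<in> \<theta>' ` ?A" "T \<in> \<theta>' ` ?A" and U: "disjoint_union S T = Some U"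
    then obtain a b where ab: "a \<in> ?A" "b \<in> ?A" "S = \<theta>' a" "T = \<theta>' b" by blast
    then obtain c where c: "pjoin P a b = Some c" using d'[of a b] U by auto
    have "U = \<theta>' c" using u'[OF ab(1,2) c] ab(3,4) U by simp
    moreover have "c \<in> ?A" using P ab(1,2) c unfolding partial_algebra_def by blast
    ultimately show "U \<in> \<theta>' ` ?A" by blast
  qed
  have bij': "bij_betw \<theta>' ?A (\<theta>' ` ?A)" using inj by (simp add: bij_betw_def)
  have z': "\<theta>' (pzero P) = {}" using z by (simp add: \<theta>'_def)
  have "representation P (\<pi> ` X) \<theta>'"
    unfolding representation_def
    by (intro exI[of _ "\<theta>' ` ?A"] conjI ballI allI impI alg bij' z' d' u')
  then show ?thesis unfolding representable_def by blast
qed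


section \<open>The first-order language \<open>L(J,0)\<close>\<close>

record 'a struc =
  dom :: "'a set"
  Jrel :: "('a \<times> 'a \<times> 'a) set"
  zero_elt :: 'a

definition structure_J0 :: "'a struc \<Rightarrow> bool" where
  "structure_J0 M \<longleftrightarrow> zero_elt M \<in> dom M \<and> Jrel M \<subseteq> dom M \<times> dom M \<times> dom M"

datatype tm = Var nat | Zero

datatype fm =
    Eq tm tm
  | J tm tm tm
  | Neg fm
  | Conj fm fm
  | All nat fm

fun tm_vars :: "tm \<Rightarrow> nat set" where
  "tm_vars (Var n) = {n}"
| "tm_vars Zero = {}"

fun free_vars :: "fm \<Rightarrow> nat set" where
  "free_vars (Eq s t) = tm_vars s \<union> tm_vars t"
| "free_vars (J s t u) = tm_vars s \<union> tm_vars t \<union> tm_vars u"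
| "free_vars (Neg p) = free_vars p"
| "free_vars (Conj p q) = free_vars p \<union> free_vars q"
| "free_vars (All n p) = free_vars p - {n}"

definition sentence :: "fm \<Rightarrow> bool" where
  "sentence p \<longleftrightarrow> free_vars p = {}"

fun tm_val :: "'a struc \<Rightarrow> (nat \<Rightarrow> 'a) \<Rightarrow> tm \<Rightarrow> 'a" where
  "tm_val M v (Var n) = v n"
| "tm_val M v Zero = zero_elt M"

fun sat :: "'a struc \<Rightarrow> (nat \<Rightarrow> 'a) \<Rightarrow> fm \<Rightarrow> bool" where
  "sat M v (Eq s t) \<longleftrightarrow> tm_val M v s = tm_val M v t"
| "sat M v (J s t u) \<longleftrightarrow> (tm_val M v s, tm_val M v t, tm_val M v u) \<in> Jrel M"
| "sat M v (Neg p) \<longleftrightarrow> \<not> sat M v p"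
| "sat M v (Conj p q) \<longleftrightarrow> sat M v p \<and> sat M v q"
| "sat M v (All n p) \<longleftrightarrow> (\<forall>a\<in>dom M. sat M (v(n := a)) p)"

definition models :: "'a struc \<Rightarrow> fm \<Rightarrow> bool" where
  "models M p \<longleftrightarrow> (\<forall>v. range v \<subseteq> dom M \<longrightarrow> sat M v p)"

text \<open>A class of structures is represented by its members with domain inside the type \<open>'a\<close>.
  Finitely many sentences axiomatising a class among all structures also axiomatise its part in
  each type \<open>'a\<close>, so refuting this predicate at an infinite \<open>'a\<close> refutes finite axiomatisability
  of the whole class. (Over a finite \<open>'a\<close> every isomorphism-closed class is finitely axiomatisable.)\<close>

definition finitely_axiomatisable :: "'a struc set \<Rightarrow> bool" where
  "finitely_axiomatisable K \<longleftrightarrow>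
     (\<exists>\<Phi>. finite \<Phi> \<and> (\<forall>p\<in>\<Phi>. sentence p) \<and>
        K = {M. structure_J0 M \<and> (\<forall>p\<in>\<Phi>. models M p)})"

definition structure_of :: "'a palg \<Rightarrow> 'a struc" where
  "structure_of P =
     \<lparr> dom = pcarrier P,
       Jrel = {(a, b, c). a \<in> pcarrier P \<and> b \<in> pcarrier P \<and> pjoin P a b = Some c},
       zero_elt = pzero P \<rparr>"

definition representable_structures :: "'a struc set" where
  "representable_structures = {structure_of P | P. partial_algebra P \<and> representable P}"

end

theory Submission
  imports Defs
begin

text \<open>On a board with row set \<open>R\<close> and column set \<open>C\<close>, take as elements the subsets of single rows
  and of single columns, with disjoint union as operation, and identify all full rows with one
  element, the board. A point of a representation lying in the board picks exactly one cell in every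
  row, and distinct cells of a column are disjoint, so it is an injection from \<open>R\<close> to \<open>C\<close>: by the
  pigeonhole principle there is no representation if \<open>card C < card R\<close>. Conversely, if \<open>C\<close> is
  larger than \<open>R\<close> by at least two, sending an element to the set of injections whose graph meets it
  is a representation. First-order logic cannot compare the two sizes: every element is a
  rectangle \<open>A \<times> B\<close>, so an Ehrenfeucht-Fraisse game of length \<open>k\<close> on two boards reduces to
  a game on subsets of the rows and a game on subsets of the columns, and these are won by the
  duplicator as soon as all the sets involved have at least \<open>2 ^ (k + 1)\<close> elements.\<close>

section \<open>Back-and-forth systems\<close>

fun qdepth :: "fm \<Rightarrow> nat" where
  "qdepth (Eq s t) = 0"
| "qdepth (J s t u) = 0"
| "qdepth (Neg p) = qdepth p"
| "qdepth (Conj p q) = max (qdepth p) (qdepth q)"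
| "qdepth (All n p) = Suc (qdepth p)"

text \<open>\<open>G k p\<close> stands for a position \<open>p\<close>, a set of pairs of chosen
  elements, from which the duplicator survives \<open>k\<close> further rounds. The pair of
  constants can be added without spending a round, so terms built from \<open>Zero\<close> fall
  under the conditions on pairs in \<open>p\<close>.\<close>

locale back_and_forth =
  fixes M :: "'a struc" and N :: "'b struc" and G :: "nat \<Rightarrow> ('a \<times> 'b) set \<Rightarrow> bool"
  assumes zero: "G k p \<Longrightarrow> G k (insert (zero_elt M, zero_elt N) p)"
    and eq_iff: "G k p \<Longrightarrow> (a, a') \<in> p \<Longrightarrow> (b, b') \<in> p \<Longrightarrow> a = b \<longleftrightarrow> a' = b'"
    and J_iff: "G k p \<Longrightarrow> (a, a') \<in> p \<Longrightarrow> (b, b') \<in> p \<Longrightarrow> (c, c') \<in> p \<Longrightarrow>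
      (a, b, c) \<in> Jrel M \<longleftrightarrow> (a', b', c') \<in> Jrel N"
    and forward: "G (Suc k) p \<Longrightarrow> a \<in> dom M \<Longrightarrow> \<exists>a'\<in>dom N. G k (insert (a, a') p)"
    and backward: "G (Suc k) p \<Longrightarrow> a' \<in> dom N \<Longrightarrow> \<exists>a\<in>dom M. G k (insert (a, a') p)"
begin

lemma tm_val_related:
  assumes "\<forall>x\<in>tm_vars t. (v x, w x) \<in> p"
  shows "(tm_val M v t, tm_val N w t) \<in> insert (zero_elt M, zero_elt N) p"
  using assms by (cases t) auto

text \<open>Induction on the formula, each quantifier spending one round: the new pair covers the
  updated variable, and \<open>insert\<close> keeps the pairs of the other free variables.\<close>

lemma sat_iff:
  assumes "G k p" "qdepth \<phi> \<le> k" "\<forall>x\<in>free_vars \<phi>. (v x, w x) \<in> p"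
  shows "sat M v \<phi> \<longleftrightarrow> sat N w \<phi>"
  using assms
proof (induction \<phi> arbitrary: k p v w)
  case (Eq s t)
  then show ?case
    using eq_iff[OF zero[OF Eq(1)] tm_val_related tm_val_related, of s v w t v w] by simp
next
  case (J s t u)
  then show ?case
    using J_iff[OF zero[OF J(1)] tm_val_related tm_val_related tm_val_related, of s v w t v w u v w]
    by simp
next
  case (All n \<phi>)
  then obtain k' where k: "k = Suc k'" "qdepth \<phi> \<le> k'" by (cases k) auto
  have *: "sat M (v(n := a)) \<phi> \<longleftrightarrow> sat N (w(n := a')) \<phi>" if "G k' (insert (a, a') p)" for a a'
    by (rule All.IH[OF that k(2)]) (use All.prems(3) in auto)
  show ?case
    using forward[of k' p] backward[of k' p] All.prems(1) * unfolding k(1) sat.simps by blast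
next
  case (Neg \<phi>)
  then show ?case by auto
next
  case (Conj \<phi> \<psi>)
  then show ?case by (metis UnCI free_vars.simps(4) max.bounded_iff qdepth.simps(4) sat.simps(4))
qed

lemma models_iff:
  assumes "G k {}" "qdepth \<phi> \<le> k" "sentence \<phi>" "zero_elt M \<in> dom M" "zero_elt N \<in> dom N"
  shows "models M \<phi> \<longleftrightarrow> models N \<phi>"
proof -
  have "sat M v \<phi> \<longleftrightarrow> sat N w \<phi>" for v w
    using sat_iff[OF assms(1,2)] assms(3) by (simp add: sentence_def)
  moreover have "range (\<lambda>_::nat. zero_elt M) \<subseteq> dom M" "range (\<lambda>_::nat. zero_elt N) \<subseteq> dom N"
    using assms by auto
  ultimately show ?thesis unfolding models_def by blast
qed

end

section \<open>Isomorphic copies of structures\<close>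

definition image_struc :: "('a \<Rightarrow> 'b) \<Rightarrow> 'a struc \<Rightarrow> 'b struc" where
  "image_struc h M =
     \<lparr> dom = h ` dom M, Jrel = (\<lambda>(a, b, c). (h a, h b, h c)) ` Jrel M, zero_elt = h (zero_elt M) \<rparr>"

lemma image_struc_simps [simp]:
  "dom (image_struc h M) = h ` dom M"
  "Jrel (image_struc h M) = (\<lambda>(a, b, c). (h a, h b, h c)) ` Jrel M"
  "zero_elt (image_struc h M) = h (zero_elt M)"
  by (simp_all add: image_struc_def)

lemma structure_J0_image_struc: "structure_J0 M \<Longrightarrow> structure_J0 (image_struc h M)"
  unfolding structure_J0_def by auto

text \<open>Between isomorphic copies the duplicator answers with \<open>h\<close> itself, for any
  number of rounds: the positions are the subsets of the graph of \<open>h\<close> on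
  \<open>dom M\<close>.\<close>

lemma models_image_struc:
  assumes M: "structure_J0 M" and h: "inj_on h (dom M)" and \<phi>: "sentence \<phi>"
  shows "models (image_struc h M) \<phi> \<longleftrightarrow> models M \<phi>"
proof -
  have J: "(a, b, c) \<in> dom M \<times> dom M \<times> dom M" if "(a, b, c) \<in> Jrel M" for a b c
    using that M unfolding structure_J0_def by blast
  interpret back_and_forth M "image_struc h M" "\<lambda>k p. p \<subseteq> (\<lambda>x. (x, h x)) ` dom M"
  proof
    fix k p a a' b b' c c'
    assume p: "p \<subseteq> (\<lambda>x. (x, h x)) ` dom M" and ab: "(a, a') \<in> p" "(b, b') \<in> p"
    show "a = b \<longleftrightarrow> a' = b'"
      using subsetD[OF p ab(1)] subsetD[OF p ab(2)] h by (auto dest: inj_onD)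
    assume "(c, c') \<in> p"
    then have *: "a \<in> dom M" "b \<in> dom M" "c \<in> dom M" "a' = h a" "b' = h b" "c' = h c"
      using p ab by auto
    show "(a, b, c) \<in> Jrel M \<longleftrightarrow> (a', b', c') \<in> Jrel (image_struc h M)"
    proof
      assume "(a', b', c') \<in> Jrel (image_struc h M)"
      then obtain x y z where "(x, y, z) \<in> Jrel M" "h a = h x" "h b = h y" "h c = h z"
        using * by auto
      with J[of x y z] * h show "(a, b, c) \<in> Jrel M" by (auto dest: inj_onD)
    qed (use * in force)
  qed (use M h in \<open>auto simp: structure_J0_def dest: inj_onD\<close>)
  show ?thesis
    using models_iff[where k = "qdepth \<phi>" and \<phi> = \<phi>] M \<phi> by (auto simp: structure_J0_def)
qed


section \<open>Representable structures\<close>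

text \<open>Representation phrased on the relation \<open>Jrel\<close> instead of a partial
  operation. In a \<open>structure_J0\<close> it makes \<open>Jrel\<close> functional: two values of
  one join have the same image, and \<open>\<theta>\<close> is injective on the domain.\<close>

definition struc_rep :: "'a struc \<Rightarrow> ('a \<Rightarrow> 'x set) \<Rightarrow> bool" where
  "struc_rep M \<theta> \<longleftrightarrow>
     inj_on \<theta> (dom M) \<and> \<theta> (zero_elt M) = {} \<and>
     (\<forall>a b c. (a, b, c) \<in> Jrel M \<longrightarrow> \<theta> a \<inter> \<theta> b = {} \<and> \<theta> a \<union> \<theta> b = \<theta> c) \<and>
     (\<forall>a\<in>dom M. \<forall>b\<in>dom M. \<theta> a \<inter> \<theta> b = {} \<longrightarrow> (\<exists>c. (a, b, c) \<in> Jrel M))"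

lemma representable_structuresD:
  fixes M :: "'a struc"
  assumes "M \<in> representable_structures"
  shows "\<exists>\<theta> :: 'a \<Rightarrow> 'a set set. struc_rep M \<theta>"
proof -
  obtain P :: "'a palg" and X :: "'a set set" and \<theta>
    where P: "M = structure_of P" and "representation P X \<theta>"
    using assms unfolding representable_structures_def representable_def by blast
  then obtain F where F: "bij_betw \<theta> (pcarrier P) F" "\<theta> (pzero P) = {}"
    and du: "\<And>a b. a \<in> pcarrier P \<Longrightarrow> b \<in> pcarrier P \<Longrightarrow>
           (pjoin P a b \<noteq> None \<longleftrightarrow> disjoint_union (\<theta> a) (\<theta> b) \<noteq> None) \<and>
           (\<forall>c. pjoin P a b = Some c \<longrightarrow> disjoint_union (\<theta> a) (\<theta> b) = Some (\<theta> c))"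
    unfolding representation_def by blast
  have "\<theta> a \<inter> \<theta> b = {} \<and> \<theta> a \<union> \<theta> b = \<theta> c" if "(a, b, c) \<in> Jrel M" for a b c
    using that du[of a b] by (auto simp: P structure_of_def disjoint_union_def split: if_splits)
  moreover have "\<exists>c. (a, b, c) \<in> Jrel M"
    if "a \<in> dom M" "b \<in> dom M" "\<theta> a \<inter> \<theta> b = {}" for a b
    using that du[of a b] by (auto simp: P structure_of_def disjoint_union_def)
  ultimately have "struc_rep M \<theta>"
    using F by (auto simp: struc_rep_def P structure_of_def bij_betw_def)
  then show ?thesis by blast
qed

text \<open>The points may have any type, because \<open>representable_any_base\<close> moves the
  base to the required one; this is what lets injections serve as points.\<close>

lemma representable_structuresI:
  fixes M :: "'a struc" and \<theta> :: "'a \<Rightarrow> 'x set"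
  assumes M: "structure_J0 M" and \<theta>: "struc_rep M \<theta>"
  shows "M \<in> representable_structures"
proof -
  have inj: "inj_on \<theta> (dom M)" and z: "\<theta> (zero_elt M) = {}"
    and J: "\<And>a b c. (a, b, c) \<in> Jrel M \<Longrightarrow> \<theta> a \<inter> \<theta> b = {} \<and> \<theta> a \<union> \<theta> b = \<theta> c"
    and ex: "\<And>a b. a \<in> dom M \<Longrightarrow> b \<in> dom M \<Longrightarrow> \<theta> a \<inter> \<theta> b = {} \<Longrightarrow> \<exists>c. (a, b, c) \<in> Jrel M"
    using \<theta> unfolding struc_rep_def by auto
  have Jd: "a \<in> dom M \<and> b \<in> dom M \<and> c \<in> dom M" if "(a, b, c) \<in> Jrel M" for a b c
    using that M unfolding structure_J0_def by blast
  have uniq: "c = d" if "(a, b, c) \<in> Jrel M" "(a, b, d) \<in> Jrel M" for a b c d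
    using J[OF that(1)] J[OF that(2)] Jd[OF that(1)] Jd[OF that(2)] inj by (metis inj_onD)
  \<comment> \<open>By \<open>uniq\<close> the description in \<open>pjoin\<close> has exactly one
    solution wherever it is used.\<close>
  define P where "P = \<lparr> pcarrier = dom M,
    pjoin = (\<lambda>a b. if \<exists>c. (a, b, c) \<in> Jrel M then Some (THE c. (a, b, c) \<in> Jrel M) else None),
    pzero = zero_elt M \<rparr>"
  have join: "pjoin P a b = Some c \<longleftrightarrow> (a, b, c) \<in> Jrel M" for a b c
  proof (cases "\<exists>d. (a, b, d) \<in> Jrel M")
    case True
    then obtain d where d: "(a, b, d) \<in> Jrel M" by blast
    then have "(THE c. (a, b, c) \<in> Jrel M) = d" by (rule the_equality) (rule uniq[OF _ d])
    then have "pjoin P a b = Some d" using True by (simp add: P_def)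
    then show ?thesis using d uniq by (metis option.inject)
  qed (auto simp: P_def)
  have carrier: "pcarrier P = dom M" "pzero P = zero_elt M" by (simp_all add: P_def)
  have alg: "partial_algebra P"
    using M Jd by (auto simp: partial_algebra_def join carrier structure_J0_def)
  have du: "disjoint_union (\<theta> a) (\<theta> b) = Some (\<theta> c)" if "(a, b, c) \<in> Jrel M" for a b c
    using J[OF that] by (simp add: disjoint_union_def)
  have defined: "pjoin P a b \<noteq> None \<longleftrightarrow> disjoint_union (\<theta> a) (\<theta> b) \<noteq> None"
    if ab: "a \<in> dom M" "b \<in> dom M" for a b
  proof
    assume "pjoin P a b \<noteq> None"
    then show "disjoint_union (\<theta> a) (\<theta> b) \<noteq> None" using du join by auto
  next
    assume "disjoint_union (\<theta> a) (\<theta> b) \<noteq> None"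
    then have "\<theta> a \<inter> \<theta> b = {}" by (auto simp: disjoint_union_def split: if_splits)
    then obtain c where "(a, b, c) \<in> Jrel M" using ex[OF ab] by blast
    then show "pjoin P a b \<noteq> None" using join by auto
  qed
  have "partial_set_algebra UNIV (\<theta> ` dom M)"
    unfolding partial_set_algebra_def
  proof (intro conjI ballI allI impI)
    show "{} \<in> \<theta> ` dom M" using z M unfolding structure_J0_def by force
    fix S T U assume "S \<in> \<theta> ` dom M" "T \<in> \<theta> ` dom M" and U: "disjoint_union S T = Some U"
    then obtain a b where ab: "a \<in> dom M" "b \<in> dom M" "S = \<theta> a" "T = \<theta> b" by blast
    then obtain c where c: "(a, b, c) \<in> Jrel M"
      using ex[of a b] U by (auto simp: disjoint_union_def split: if_splits)
    show "U \<in> \<theta> ` dom M" using du[OF c] ab U Jd[OF c] by auto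
  qed simp
  then have "representation P UNIV \<theta>"
    unfolding representation_def carrier
    by (intro exI[of _ "\<theta> ` dom M"] conjI ballI allI impI defined z inj_on_imp_bij_betw inj du)
      (simp_all add: join)
  then have "representable P" by (rule representable_any_base[OF alg])
  moreover have "structure_of P = M"
    using Jd by (cases M) (auto simp: structure_of_def join carrier)
  ultimately show ?thesis using alg unfolding representable_structures_def by blast
qed

lemma struc_rep_image_struc:
  assumes M: "structure_J0 M" and h: "inj_on h (dom M)"
  shows "struc_rep (image_struc h M) \<theta> \<longleftrightarrow> struc_rep M (\<theta> \<circ> h)"
proof -
  have Jd: "a \<in> dom M \<and> b \<in> dom M \<and> c \<in> dom M" if "(a, b, c) \<in> Jrel M" for a b c
    using that M unfolding structure_J0_def by blast
  have J: "(h a, h b, c') \<in> Jrel (image_struc h M) \<longleftrightarrow> (\<exists>c. c' = h c \<and> (a, b, c) \<in> Jrel M)"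
    if "a \<in> dom M" "b \<in> dom M" for a b c'
  proof
    assume "(h a, h b, c') \<in> Jrel (image_struc h M)"
    then obtain x y c where "(x, y, c) \<in> Jrel M" "h a = h x" "h b = h y" "c' = h c" by auto
    with Jd[of x y c] that h show "\<exists>c. c' = h c \<and> (a, b, c) \<in> Jrel M" by (metis inj_onD)
  qed force
  have 1: "inj_on \<theta> (h ` dom M) \<longleftrightarrow> inj_on (\<theta> \<circ> h) (dom M)"
    using h by (metis comp_inj_on inj_on_imageI)
  have 2: "(\<forall>a b c. (a, b, c) \<in> Jrel (image_struc h M) \<longrightarrow> \<theta> a \<inter> \<theta> b = {} \<and> \<theta> a \<union> \<theta> b = \<theta> c) \<longleftrightarrow>
    (\<forall>a b c. (a, b, c) \<in> Jrel M \<longrightarrow> \<theta> (h a) \<inter> \<theta> (h b) = {} \<and> \<theta> (h a) \<union> \<theta> (h b) = \<theta> (h c))"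
    (is "?l \<longleftrightarrow> ?r")
  proof
    assume l: ?l
    have "(h a, h b, h c) \<in> Jrel (image_struc h M)" if "(a, b, c) \<in> Jrel M" for a b c
      using that by force
    then show ?r using l by blast
  next
    assume r: ?r
    have "\<exists>x y z. a = h x \<and> b = h y \<and> c = h z \<and> (x, y, z) \<in> Jrel M"
      if "(a, b, c) \<in> Jrel (image_struc h M)" for a b c
      using that by auto
    then show ?l using r by metis
  qed
  have 3: "(\<exists>c. (h a, h b, c) \<in> Jrel (image_struc h M)) \<longleftrightarrow> (\<exists>c. (a, b, c) \<in> Jrel M)"
    if "a \<in> dom M" "b \<in> dom M" for a b
    using J[OF that] by blast
  show ?thesis
    unfolding struc_rep_def image_struc_simps(1,3) ball_simps 2 1 using 3 by (simp add: o_def)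
qed

lemma image_struc_representable_iff:
  fixes h :: "'a \<Rightarrow> 'b"
  assumes M: "structure_J0 M" and h: "inj_on h (dom M)"
  shows "(image_struc h M \<in> representable_structures) \<longleftrightarrow> (M \<in> representable_structures)"
proof
  assume "image_struc h M \<in> representable_structures"
  then show "M \<in> representable_structures"
    using representable_structuresD representable_structuresI[OF M]
      struc_rep_image_struc[OF M h] by blast
next
  assume "M \<in> representable_structures"
  then obtain \<theta> :: "'a \<Rightarrow> 'a set set" where \<theta>: "struc_rep M \<theta>"
    using representable_structuresD by blast
  \<comment> \<open>The composite agrees with \<open>\<theta>\<close> only on \<open>dom M\<close>;
    this suffices because \<open>Jrel M\<close> lies inside the domain.\<close>
  have "struc_rep M ((\<theta> \<circ> inv_into (dom M) h) \<circ> h)"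
  proof -
    have eq: "((\<theta> \<circ> inv_into (dom M) h) \<circ> h) x = \<theta> x" if "x \<in> dom M" for x
      using that h by simp
    have Jd: "a \<in> dom M \<and> b \<in> dom M \<and> c \<in> dom M" if "(a, b, c) \<in> Jrel M" for a b c
      using that M unfolding structure_J0_def by blast
    have "inj_on ((\<theta> \<circ> inv_into (dom M) h) \<circ> h) (dom M) \<longleftrightarrow> inj_on \<theta> (dom M)"
      using eq by (rule inj_on_cong)
    moreover have "zero_elt M \<in> dom M" using M by (simp add: structure_J0_def)
    ultimately show ?thesis
      using \<theta> Jd unfolding struc_rep_def by (simp add: eq del: o_apply)
  qed
  then have "struc_rep (image_struc h M) (\<theta> \<circ> inv_into (dom M) h)"
    using struc_rep_image_struc[OF M h] by blast
  then show "image_struc h M \<in> representable_structures"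
    by (rule representable_structuresI[OF structure_J0_image_struc[OF M]])
qed


section \<open>The rook structures\<close>

lemma ex_two_elements:
  assumes "2 \<le> card A"
  shows "\<exists>x\<in>A. \<exists>y\<in>A. x \<noteq> y"
proof (rule ccontr)
  assume "\<not> ?thesis"
  moreover have "finite A" using assms by (auto intro: card_ge_0_finite)
  ultimately have "card A \<le> Suc 0" by (simp add: card_le_Suc0_iff_eq)
  then show False using assms by simp
qed

definition single_row :: "('r \<times> 'c) set \<Rightarrow> bool" where
  "single_row E \<longleftrightarrow> (\<forall>x y x' y'. (x, y) \<in> E \<longrightarrow> (x', y') \<in> E \<longrightarrow> x = x')"

definition single_col :: "('r \<times> 'c) set \<Rightarrow> bool" where
  "single_col E \<longleftrightarrow> (\<forall>x y x' y'. (x, y) \<in> E \<longrightarrow> (x', y') \<in> E \<longrightarrow> y = y')"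

definition full_row :: "'r set \<Rightarrow> 'c set \<Rightarrow> ('r \<times> 'c) set \<Rightarrow> bool" where
  "full_row R C E \<longleftrightarrow> single_row E \<and> (\<exists>x\<in>R. \<forall>y\<in>C. (x, y) \<in> E)"

text \<open>The full rows are identified with each other; the board \<open>R \<times> C\<close> stands for their common
  value.\<close>

definition rook_carrier :: "'r set \<Rightarrow> 'c set \<Rightarrow> ('r \<times> 'c) set set" where
  "rook_carrier R C = {E. E \<subseteq> R \<times> C \<and>
     ((single_row E \<or> single_col E) \<and> \<not> full_row R C E \<or> E = R \<times> C)}"

text \<open>Pieces that together fill a row join to the board, the common value of all full
  rows.\<close>

definition rook_J :: "'r set \<Rightarrow> 'c set \<Rightarrow> ('r \<times> 'c) set \<Rightarrow> ('r \<times> 'c) set \<Rightarrow> ('r \<times> 'c) set \<Rightarrow> bool" where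
  "rook_J R C E F H \<longleftrightarrow>
     E \<in> rook_carrier R C \<and> F \<in> rook_carrier R C \<and> H \<in> rook_carrier R C \<and>
     E \<inter> F = {} \<and> (E \<union> F = H \<or> full_row R C (E \<union> F) \<and> H = R \<times> C)"

definition rook :: "'r set \<Rightarrow> 'c set \<Rightarrow> ('r \<times> 'c) set struc" where
  "rook R C =
     \<lparr> dom = rook_carrier R C, Jrel = {(E, F, H). rook_J R C E F H}, zero_elt = {} \<rparr>"

lemma rook_simps [simp]:
  "dom (rook R C) = rook_carrier R C"
  "(E, F, H) \<in> Jrel (rook R C) \<longleftrightarrow> rook_J R C E F H"
  "zero_elt (rook R C) = {}"
  by (simp_all add: rook_def)

lemma empty_in_rook_carrier: "C \<noteq> {} \<Longrightarrow> {} \<in> rook_carrier R C"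
  by (auto simp: rook_carrier_def single_row_def full_row_def)

lemma structure_J0_rook:
  assumes "C \<noteq> {}"
  shows "structure_J0 (rook R C)"
  using empty_in_rook_carrier[OF assms]
  by (auto simp: structure_J0_def rook_def rook_J_def)

lemma finite_rook_carrier: "finite R \<Longrightarrow> finite C \<Longrightarrow> finite (rook_carrier R C)"
  by (rule finite_subset[of _ "Pow (R \<times> C)"]) (auto simp: rook_carrier_def)

text \<open>Splits a move of the game into a set of rows and a set of columns, which can be answered
  independently.\<close>

lemma rook_carrier_rectangle:
  assumes "E \<in> rook_carrier R C"
  obtains A B where "A \<subseteq> R" "B \<subseteq> C" "E = A \<times> B"
proof
  show "fst ` E \<subseteq> R" "snd ` E \<subseteq> C" using assms by (auto simp: rook_carrier_def)
  show "E = fst ` E \<times> snd ` E"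
  proof (intro equalityI subsetI)
    fix z assume "z \<in> fst ` E \<times> snd ` E"
    then obtain x y x' y' where z: "z = (x, y)" and xy: "(x, y') \<in> E" "(x', y) \<in> E" by auto
    have "single_row E \<or> single_col E \<or> E = R \<times> C" using assms by (simp add: rook_carrier_def) blast
    then show "z \<in> E"
    proof (elim disjE)
      assume "single_row E"
      then show ?thesis using xy z unfolding single_row_def by blast
    next
      assume "single_col E"
      then show ?thesis using xy z unfolding single_col_def by blast
    qed (use xy z in blast)
  qed (auto simp: rev_image_eqI)
qed

lemma row_in_rook_carrier: "i \<in> R \<Longrightarrow> S \<subset> C \<Longrightarrow> {i} \<times> S \<in> rook_carrier R C"
  by (auto simp: rook_carrier_def full_row_def single_row_def)

lemma col_in_rook_carrier:
  "T \<subseteq> R \<Longrightarrow> {j} \<subset> C \<Longrightarrow> T \<times> {j} \<in> rook_carrier R C"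
  by (auto simp: rook_carrier_def full_row_def single_col_def)

section \<open>Boards with too few columns\<close>

lemma rook_not_representable:
  fixes R :: "'r set" and C :: "'c set"
  assumes fin: "finite C" "finite R" and C: "card C \<ge> 2" and RC: "card C < card R"
  shows "rook R C \<notin> representable_structures"
proof
  assume "rook R C \<in> representable_structures"
  then obtain \<theta> :: "('r \<times> 'c) set \<Rightarrow> ('r \<times> 'c) set set set" where "struc_rep (rook R C) \<theta>"
    using representable_structuresD by blast
  then have inj: "inj_on \<theta> (rook_carrier R C)" and z: "\<theta> {} = {}"
    and J: "\<And>E F H. rook_J R C E F H \<Longrightarrow> \<theta> E \<inter> \<theta> F = {} \<and> \<theta> E \<union> \<theta> F = \<theta> H"
    by (simp_all add: struc_rep_def)
  \<comment> \<open>With two columns or more, a single cell is a proper part of its row, hence an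
    element.\<close>
  have sing: "{j} \<subset> C" if "j \<in> C" for j
    using that C by (cases "C = {j}") auto
  have ne: "C \<noteq> {}" "R \<noteq> {}" using C RC by auto
  have board: "R \<times> C \<in> rook_carrier R C" by (simp add: rook_carrier_def)
  have "\<theta> (R \<times> C) \<noteq> {}"
    using inj_onD[OF inj _ board empty_in_rook_carrier[OF ne(1)]] z ne by auto
  then obtain p where p: "p \<in> \<theta> (R \<times> C)" by blast
  \<comment> \<open>Cells are peeled off one at a time, each time splitting the image by a join,
    until the cell containing \<open>p\<close> is found.\<close>
  have row: "\<exists>y\<in>S. p \<in> \<theta> {(i, y)}" if "i \<in> R" "finite S" "S \<subset> C" "p \<in> \<theta> ({i} \<times> S)" for i S
    using that(2,3,4)
  proof (induction S)
    case (insert y S)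
    have "rook_J R C {(i, y)} ({i} \<times> S) ({i} \<times> insert y S)"
      using row_in_rook_carrier[OF that(1), of "{y}" C] row_in_rook_carrier[OF that(1), of S C]
        row_in_rook_carrier[OF that(1), of "insert y S" C] insert.hyps insert.prems sing[of y]
      by (auto simp: rook_J_def)
    then have "p \<in> \<theta> {(i, y)} \<or> p \<in> \<theta> ({i} \<times> S)" using J insert.prems by blast
    then show ?case using insert by blast
  qed (use z in simp)
  obtain y0 where y0: "y0 \<in> C" using ne by blast
  \<comment> \<open>A full row is represented only by the board, so \<open>row\<close> does not
    apply to it directly. The cell \<open>(i, y0)\<close> is split off; it and the rest of the row
    join to the board, whose image contains \<open>p\<close>.\<close>
  have "\<exists>y\<in>C. p \<in> \<theta> {(i, y)}" if "i \<in> R" for i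
  proof -
    have "{i} \<times> (C - {y0}) \<union> {(i, y0)} = {i} \<times> C" using y0 by auto
    moreover have "full_row R C ({i} \<times> C)" using that by (auto simp: full_row_def single_row_def)
    ultimately have "rook_J R C ({i} \<times> (C - {y0})) {(i, y0)} (R \<times> C)"
      using row_in_rook_carrier[OF that, of "{y0}" C] sing[OF y0] board y0
        row_in_rook_carrier[OF that, of "C - {y0}" C]
      by (auto simp: rook_J_def)
    then have "p \<in> \<theta> ({i} \<times> (C - {y0})) \<or> p \<in> \<theta> {(i, y0)}" using J p by blast
    then show ?thesis using row[OF that, of "C - {y0}"] fin y0 by blast
  qed
  then obtain g where g: "\<And>i. i \<in> R \<Longrightarrow> g i \<in> C \<and> p \<in> \<theta> {(i, g i)}" by metis
  have "\<not> inj_on g R"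
  proof
    assume "inj_on g R"
    then have "card R \<le> card C" using g fin by (intro card_inj_on_le[of g]) auto
    then show False using RC by simp
  qed
  then obtain i i' where i: "i \<in> R" "i' \<in> R" "g i = g i'" "i \<noteq> i'" by (auto simp: inj_on_def)
  \<comment> \<open>Two cells of one column have a join, so their images are disjoint, yet both
    contain \<open>p\<close>.\<close>
  have "rook_J R C {(i, g i)} {(i', g i)} ({i, i'} \<times> {g i})"
    using col_in_rook_carrier[of "{i}" R "g i" C] col_in_rook_carrier[of "{i'}" R "g i" C]
      col_in_rook_carrier[of "{i, i'}" R "g i" C] sing[of "g i"] g i
    by (auto simp: rook_J_def)
  then show False using J g i by (metis disjoint_iff)
qed

section \<open>Placements of one rook in every row\<close>

lemma injection_extending:
  assumes fin: "finite R" "finite C" and D: "D \<subseteq> R" and inj: "inj_on \<sigma> D" and im: "\<sigma> ` D \<subseteq> C"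
    and Z: "finite Z" "card R + card Z \<le> card C"
  obtains \<pi> where "inj_on \<pi> R" "\<pi> ` R \<subseteq> C" "\<And>x. x \<in> D \<Longrightarrow> \<pi> x = \<sigma> x"
    "\<And>x. x \<in> R - D \<Longrightarrow> \<pi> x \<notin> Z"
proof -
  have fD: "finite D" using D fin finite_subset by blast
  have "card (\<sigma> ` D) = card D" using inj by (rule card_image)
  moreover have "card D \<le> card R" using D fin by (intro card_mono)
  moreover have "card (R - D) = card R - card D" using D fD by (simp add: card_Diff_subset)
  moreover have "card (C - \<sigma> ` D) = card C - card (\<sigma> ` D)" using im fD by (simp add: card_Diff_subset)
  moreover have "card (C - \<sigma> ` D - Z) \<ge> card (C - \<sigma> ` D) - card Z"
    using diff_card_le_card_Diff[OF Z(1)] by blast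
  \<comment> \<open>\<open>\<sigma>\<close> uses one column for each row of \<open>D\<close>.
    Removing these and the forbidden columns \<open>Z\<close> leaves enough columns for the
    remaining rows.\<close>
  ultimately have "card (R - D) \<le> card (C - \<sigma> ` D - Z)" using Z by linarith
  then obtain \<tau> where \<tau>: "\<tau> ` (R - D) \<subseteq> C - \<sigma> ` D - Z" "inj_on \<tau> (R - D)"
    using fin card_le_inj[of "R - D" "C - \<sigma> ` D - Z"] by blast
  define \<pi> where "\<pi> x = (if x \<in> D then \<sigma> x else \<tau> x)" for x
  have \<tau>': "\<tau> x \<in> C \<and> \<tau> x \<notin> \<sigma> ` D \<and> \<tau> x \<notin> Z" if "x \<in> R" "x \<notin> D" for x
    using \<tau>(1) that by blast
  show thesis
  proof
    show "inj_on \<pi> R"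
      using inj \<tau>(2) \<tau>' D unfolding inj_on_def \<pi>_def by (metis DiffI imageI)
    show "\<pi> ` R \<subseteq> C" using im \<tau>' by (auto simp: \<pi>_def)
  qed (use \<tau>' in \<open>auto simp: \<pi>_def\<close>)
qed

text \<open>Such a \<open>\<pi>\<close> places non-attacking rooks, one in each row. Its values
  outside \<open>R\<close> are arbitrary, which merely duplicates points.\<close>

definition placements :: "'r set \<Rightarrow> 'c set \<Rightarrow> ('r \<times> 'c) set \<Rightarrow> ('r \<Rightarrow> 'c) set" where
  "placements R C E = {\<pi>. inj_on \<pi> R \<and> \<pi> ` R \<subseteq> C \<and> (\<exists>x\<in>R. (x, \<pi> x) \<in> E)}"

context
  fixes R :: "'r set" and C :: "'c set"
  assumes fin: "finite R" "finite C" and RC: "card R + 2 \<le> card C"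
begin

text \<open>Two cells that coincide, or share neither row nor column, can be occupied together. The
  surplus of columns leaves room to keep all other rooks out of a chosen column
  \<open>j\<close>.\<close>

lemma placement_through:
  assumes "x \<in> R" "y \<in> C" "x' \<in> R" "y' \<in> C" "x = x' \<longleftrightarrow> y = y'"
  obtains \<pi> where "inj_on \<pi> R" "\<pi> ` R \<subseteq> C" "\<pi> x = y" "\<pi> x' = y'"
    "\<And>u. u \<in> R \<Longrightarrow> u \<noteq> x \<Longrightarrow> u \<noteq> x' \<Longrightarrow> \<pi> u \<noteq> j"
proof -
  define \<sigma> where "\<sigma> u = (if u = x then y else y')" for u
  have "inj_on \<sigma> {x, x'}" "\<sigma> ` {x, x'} \<subseteq> C" using assms by (auto simp: \<sigma>_def inj_on_def)
  moreover have "card R + card {j} \<le> card C" using RC by simp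
  ultimately obtain \<pi> where "inj_on \<pi> R" "\<pi> ` R \<subseteq> C" "\<And>u. u \<in> {x, x'} \<Longrightarrow> \<pi> u = \<sigma> u"
    "\<And>u. u \<in> R - {x, x'} \<Longrightarrow> \<pi> u \<notin> {j}"
    using assms injection_extending[OF fin, of "{x, x'}" \<sigma> "{j}"] by blast
  then show thesis using assms by (intro that[of \<pi>]) (auto simp: \<sigma>_def)
qed


text \<open>If every placement meets \<open>E\<close> exactly when it meets \<open>F\<close>,
  placements through \<open>(x, y)\<close> force \<open>F\<close> to be another row without its cell
  in column \<open>y\<close>. Each possible shape of \<open>E\<close> is then refuted by one
  placement.\<close>

lemma placements_separate:
  assumes R: "card R \<ge> 2" and E: "E \<in> rook_carrier R C" and F: "F \<in> rook_carrier R C"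
    and e: "(x, y) \<in> E" "(x, y) \<notin> F"
  shows "placements R C E \<noteq> placements R C F"
proof
  assume eq: "placements R C E = placements R C F"
  have hit: "(\<exists>u\<in>R. (u, \<pi> u) \<in> E) \<longleftrightarrow> (\<exists>u\<in>R. (u, \<pi> u) \<in> F)" if "inj_on \<pi> R" "\<pi> ` R \<subseteq> C" for \<pi>
    using eq that unfolding placements_def by blast
  have xy: "x \<in> R" "y \<in> C" using E e by (auto simp: rook_carrier_def)
  have "F \<noteq> R \<times> C" using e xy by auto
  then have F': "single_row F \<or> single_col F" "\<not> full_row R C F" "F \<subseteq> R \<times> C"
    using F by (auto simp: rook_carrier_def)
  \<comment> \<open>The rook on \<open>(x, y)\<close> misses \<open>F\<close>, and all others are
    kept out of the column of \<open>F\<close>. This case includes \<open>F = {}\<close>.\<close>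
  have "\<not> single_col F"
  proof
    assume "single_col F"
    then obtain j where j: "\<And>u v. (u, v) \<in> F \<Longrightarrow> v = j" unfolding single_col_def by metis
    obtain \<pi> where "inj_on \<pi> R" "\<pi> ` R \<subseteq> C" "\<pi> x = y" "\<And>u. u \<in> R \<Longrightarrow> u \<noteq> x \<Longrightarrow> \<pi> u \<noteq> j"
      using placement_through[of x y x y j] xy by metis
    then show False using hit[of \<pi>] j e xy by metis
  qed
  then have "F \<noteq> {}" "single_row F" using F' by (auto simp: single_col_def)
  then obtain i w where iw: "(i, w) \<in> F" and i: "\<And>u v. (u, v) \<in> F \<Longrightarrow> u = i"
    unfolding single_row_def by (metis ex_in_conv surj_pair)
  have iw': "i \<in> R" "w \<in> C" using iw F' by auto
  have ix: "i \<noteq> x"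
  proof
    assume "i = x"
    obtain \<pi> where "inj_on \<pi> R" "\<pi> ` R \<subseteq> C" "\<pi> x = y"
      using placement_through[of x y x y] xy by metis
    then show False using hit[of \<pi>] i \<open>i = x\<close> e xy by metis
  qed
  \<comment> \<open>A placement through \<open>(x, y)\<close> meets \<open>E\<close>, so it must
    meet \<open>F\<close>, and it can do so only in row \<open>i\<close>, at
    \<open>(i, z)\<close>.\<close>
  have rest: "(i, z) \<in> F" if zy: "z \<in> C" "z \<noteq> y" for z
  proof (rule ccontr)
    assume "(i, z) \<notin> F"
    moreover obtain \<pi> where "inj_on \<pi> R" "\<pi> ` R \<subseteq> C" "\<pi> x = y" "\<pi> i = z"
      using placement_through[of x y i z] xy iw' ix zy by metis
    ultimately show False using hit[of \<pi>] i e xy by metis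
  qed
  have iy: "(i, y) \<notin> F"
    using F'(2) \<open>single_row F\<close> rest iw' unfolding full_row_def by metis
  have wy: "w \<noteq> y" using iw iy by auto
  have "E \<noteq> R \<times> C"
  proof
    assume "E = R \<times> C"
    moreover obtain \<pi> where "inj_on \<pi> R" "\<pi> ` R \<subseteq> C" "\<pi> x = w" "\<pi> i = y"
      using placement_through[of x w i y] xy iw' ix wy by metis
    ultimately show False using hit[of \<pi>] i iy xy iw' by (metis SigmaI)
  qed
  then have E': "single_row E \<or> single_col E" "\<not> full_row R C E"
    using E by (auto simp: rook_carrier_def)
  \<comment> \<open>Here \<open>E\<close> would lie in column \<open>y\<close>. A rook on
    \<open>(i, w)\<close> meets \<open>F\<close>, while all rooks stay out of column
    \<open>y\<close>.\<close>
  have "\<not> single_col E"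
  proof
    assume "single_col E"
    then have "\<And>u v. (u, v) \<in> E \<Longrightarrow> v = y" using e unfolding single_col_def by blast
    moreover obtain \<pi> where "inj_on \<pi> R" "\<pi> ` R \<subseteq> C" "\<pi> i = w" "\<And>u. u \<in> R \<Longrightarrow> u \<noteq> i \<Longrightarrow> \<pi> u \<noteq> y"
      using placement_through[of i w i w y] iw' by metis
    ultimately show False using hit[of \<pi>] iw iw' wy by metis
  qed
  then have row: "single_row E" using E' by blast
  then obtain z where z: "z \<in> C" "(x, z) \<notin> E" using E' xy unfolding full_row_def by blast
  \<comment> \<open>A third column \<open>w'\<close> allows a placement meeting \<open>F\<close> at
    \<open>(i, w')\<close> and leaving \<open>E\<close> through its gap
    \<open>(x, z)\<close>.\<close>
  have "\<not> C \<subseteq> {y, z}"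
    using card_mono[of "{y, z}" C] card_insert_le_m1[of 2 "{z}" y] RC R by auto
  then obtain w' where w': "w' \<in> C" "w' \<noteq> y" "w' \<noteq> z" by blast
  obtain \<pi> where \<pi>: "inj_on \<pi> R" "\<pi> ` R \<subseteq> C" "\<pi> x = z" "\<pi> i = w'"
    using placement_through[of x z i w'] xy iw' ix z w' by metis
  have "\<not> (\<exists>u\<in>R. (u, \<pi> u) \<in> E)" using row e z \<pi>(3) unfolding single_row_def by metis
  then show False using hit[OF \<pi>(1,2)] rest[OF w'(1,2)] \<pi>(4) iw' by metis
qed

text \<open>Removing one column leaves a block with at least two rows and two columns, which lies in
  no single line; and two row pieces covering the board would have to be full rows. Hence a join of
  two proper pieces stays inside one line.\<close>

lemma union_lines_not_board:
  assumes R: "card R \<ge> 2"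
    and E: "single_row E \<or> single_col E" "\<not> full_row R C E"
    and F: "single_row F \<or> single_col F" "\<not> full_row R C F"
  shows "E \<union> F \<noteq> R \<times> C"
proof
  assume eq: "E \<union> F = R \<times> C"
  obtain x1 x2 where x: "x1 \<in> R" "x2 \<in> R" "x1 \<noteq> x2"
    using ex_two_elements[OF R] by blast
  have no_col: False if AB: "A \<union> B = R \<times> C" "single_col A" "single_row B \<or> single_col B" for A B
  proof -
    obtain j where j: "\<And>u v. (u, v) \<in> A \<Longrightarrow> v = j" using AB(2) unfolding single_col_def by metis
    have "card (C - {j}) \<ge> 2" using RC R diff_card_le_card_Diff[of "{j}" C] by simp
    then obtain y1 y2 where y: "y1 \<in> C - {j}" "y2 \<in> C - {j}" "y1 \<noteq> y2"
      using ex_two_elements by blast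
    have "(u, v) \<in> B" if "u \<in> R" "v \<in> C - {j}" for u v
      using j[of u v] that AB(1) by blast
    then have "(x1, y1) \<in> B" "(x1, y2) \<in> B" "(x2, y1) \<in> B" using x y by auto
    then show False using AB(3) x y unfolding single_row_def single_col_def by blast
  qed
  have rows: "single_row E" "single_row F"
    using no_col[of E F] no_col[of F E] eq E F by (auto simp: Un_commute)
  obtain y where y: "y \<in> C" using RC R by fastforce
  have full: "full_row R C A"
    if "A \<union> B = R \<times> C" "single_row A" "single_row B" "(x1, y) \<in> A" for A B
  proof -
    have "(x2, y) \<in> B" using that x y unfolding single_row_def by blast
    then have "(x1, v) \<in> A" if "v \<in> C" for v
      using that \<open>A \<union> B = R \<times> C\<close> \<open>single_row B\<close> x unfolding single_row_def by blast
    then show ?thesis using that(2) x unfolding full_row_def by blast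
  qed
  show False using full[of E F] full[of F E] eq rows E F x y by (auto simp: Un_commute)
qed

lemma rook_representable:
  assumes R: "card R \<ge> 2"
  shows "rook R C \<in> representable_structures"
proof (rule representable_structuresI)
  have ne: "R \<noteq> {}" "C \<noteq> {}" using R RC by auto
  show "structure_J0 (rook R C)" using ne by (simp add: structure_J0_rook)
  show "struc_rep (rook R C) (placements R C)"
    unfolding struc_rep_def rook_simps
  proof (intro conjI ballI allI impI)
    show "inj_on (placements R C) (rook_carrier R C)"
    proof (rule inj_onI)
      fix E F
      assume EF: "E \<in> rook_carrier R C" "F \<in> rook_carrier R C" "placements R C E = placements R C F"
      show "E = F"
      proof (intro equalityI subrelI)
        show "(x, y) \<in> F" if "(x, y) \<in> E" for x y
          using placements_separate[OF R EF(1,2) that] EF(3) by blast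
        show "(x, y) \<in> E" if "(x, y) \<in> F" for x y
          using placements_separate[OF R EF(2,1) that] EF(3) by blast
      qed
    qed
    show "placements R C {} = {}" by (simp add: placements_def)
  next
    fix E F H assume J: "rook_J R C E F H"
    then have EF: "E \<in> rook_carrier R C" "F \<in> rook_carrier R C" "E \<inter> F = {}"
      "E \<union> F = H \<or> full_row R C (E \<union> F) \<and> H = R \<times> C"
      and H: "H \<in> rook_carrier R C"
      by (simp_all add: rook_J_def)
    have sub: "E \<subseteq> R \<times> C" "F \<subseteq> R \<times> C" using EF by (simp_all add: rook_carrier_def)
    have "placements R C E \<union> placements R C F = placements R C (E \<union> F)"
      by (auto simp: placements_def)
    \<comment> \<open>Every placement has a rook in every row, so it meets a full row as surely as
      the board. This is why identifying the full rows is harmless.\<close>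
    moreover have "placements R C (E \<union> F) = placements R C (R \<times> C)" if full: "full_row R C (E \<union> F)"
    proof -
      obtain x where "x \<in> R" "\<forall>y\<in>C. (x, y) \<in> E \<union> F" using full unfolding full_row_def by blast
      then show ?thesis unfolding placements_def by blast
    qed
    ultimately show "placements R C E \<union> placements R C F = placements R C H"
      using EF(4) by metis
    show "placements R C E \<inter> placements R C F = {}"
    proof (cases "E = R \<times> C \<or> F = R \<times> C")
      case True
      then have "E = {} \<or> F = {}" using EF(3) sub by blast
      then show ?thesis by (auto simp: placements_def)
    next
      case False
      then have "E \<union> F \<noteq> R \<times> C"
        using EF(1,2) union_lines_not_board[OF R] by (simp add: rook_carrier_def)
      then have line: "single_row (E \<union> F) \<or> single_col (E \<union> F)"
        using EF(4) H by (auto simp: rook_carrier_def full_row_def)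
      \<comment> \<open>Rooks do not attack each other, so two rooks on one line are the same
        rook.\<close>
      have "x = x'"
        if \<pi>: "inj_on \<pi> R" "x \<in> R" "x' \<in> R" "(x, \<pi> x) \<in> E" "(x', \<pi> x') \<in> F" for \<pi> x x'
        using line
      proof
        assume "single_row (E \<union> F)"
        then show ?thesis using \<pi>(4,5) unfolding single_row_def by blast
      next
        assume "single_col (E \<union> F)"
        then have "\<pi> x = \<pi> x'" using \<pi>(4,5) unfolding single_col_def by blast
        then show ?thesis using \<pi>(1-3) by (simp add: inj_on_eq_iff)
      qed
      then show ?thesis using EF(3) unfolding placements_def by blast
    qed
  next
    fix E F assume E: "E \<in> rook_carrier R C" and F: "F \<in> rook_carrier R C"
      and disj: "placements R C E \<inter> placements R C F = {}"
    have sub: "E \<subseteq> R \<times> C" "F \<subseteq> R \<times> C" using E F by (auto simp: rook_carrier_def)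
    \<comment> \<open>Otherwise one placement would pass through both cells. So a cell of
      \<open>E\<close> and a cell of \<open>F\<close> share exactly one of row and column.\<close>
    have cells: "(x = x') \<noteq> (y = y')" if "(x, y) \<in> E" "(x', y') \<in> F" for x y x' y'
    proof
      assume *: "(x = x') = (y = y')"
      have "x \<in> R" "y \<in> C" "x' \<in> R" "y' \<in> C" using that sub by auto
      then obtain \<pi> where "inj_on \<pi> R" "\<pi> ` R \<subseteq> C" "\<pi> x = y" "\<pi> x' = y'"
        using placement_through[of x y x' y'] * by metis
      then show False using disj that \<open>x \<in> R\<close> \<open>x' \<in> R\<close> unfolding placements_def by blast
    qed
    have EF: "E \<inter> F = {}" using cells by fastforce
    show "\<exists>H. rook_J R C E F H"
    proof (cases "E = {} \<or> F = {}")
      case True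
      then show ?thesis using E F unfolding rook_J_def by auto
    next
      case False
      then have "E \<noteq> R \<times> C" "F \<noteq> R \<times> C" using EF sub by blast+
      then have l: "single_row E \<or> single_col E" "single_row F \<or> single_col F"
        using E F by (auto simp: rook_carrier_def)
      obtain x y where xy: "(x, y) \<in> E" using False by auto
      obtain x' y' where xy': "(x', y') \<in> F" using False by auto
      \<comment> \<open>The kind of line shared by one pair of cells decides: as \<open>E\<close>
        and \<open>F\<close> are themselves lines, all their other cells must lie on that same
        line.\<close>
      have line: "single_row (E \<union> F) \<or> single_col (E \<union> F)"
      proof (cases "x = x'")
        case True
        have "u = x" if "(u, v) \<in> E" for u v
          using cells[OF that xy'] cells[OF xy xy'] xy that l(1) True
          unfolding single_row_def single_col_def by blast
        moreover have "u = x" if "(u, v) \<in> F" for u v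
          using cells[OF xy that] cells[OF xy xy'] xy' that l(2) True
          unfolding single_row_def single_col_def by blast
        ultimately show ?thesis unfolding single_row_def by blast
      next
        case False
        have "v = y" if "(u, v) \<in> E" for u v
          using cells[OF that xy'] cells[OF xy xy'] xy that l(1) False
          unfolding single_row_def single_col_def by blast
        moreover have "v = y" if "(u, v) \<in> F" for u v
          using cells[OF xy that] cells[OF xy xy'] xy' that l(2) False
          unfolding single_row_def single_col_def by blast
        ultimately show ?thesis unfolding single_col_def by blast
      qed
      show ?thesis
      proof (cases "full_row R C (E \<union> F)")
        case True
        then show ?thesis using E F EF unfolding rook_J_def by (auto simp: rook_carrier_def)
      next
        case False
        then have "E \<union> F \<in> rook_carrier R C" using line sub by (auto simp: rook_carrier_def)
        then show ?thesis using E F EF unfolding rook_J_def by auto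
      qed
    qed
  qed
qed

end


section \<open>Colourings with equal class sizes up to a threshold\<close>

definition close :: "nat \<Rightarrow> nat \<Rightarrow> nat \<Rightarrow> bool" where
  "close k m n \<longleftrightarrow> m = n \<or> 2 ^ k \<le> m \<and> 2 ^ k \<le> n"

text \<open>If the sizes differ, both are at least \<open>2 * 2 ^ k\<close>, so at most one part of
  \<open>m\<close> is below \<open>2 ^ k\<close>. A small part is copied exactly, leaving a large
  remainder; if both parts are large, \<open>b = 2 ^ k\<close> serves.\<close>

lemma close_split:
  assumes "close (Suc k) m n" "a \<le> m"
  shows "\<exists>b\<le>n. close k a b \<and> close k (m - a) (n - b)"
proof (cases "m = n")
  case True
  then show ?thesis using assms by (auto simp: close_def)
next
  case False
  then have *: "2 * 2 ^ k \<le> m" "2 * 2 ^ k \<le> n" using assms by (auto simp: close_def)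
  consider "a < 2 ^ k" | "m - a < 2 ^ k" | "2 ^ k \<le> a" "2 ^ k \<le> m - a" by linarith
  then show ?thesis
  proof cases
    case 1
    then show ?thesis using * by (intro exI[of _ a]) (auto simp: close_def)
  next
    case 2
    then show ?thesis using * assms(2) by (intro exI[of _ "n - (m - a)"]) (auto simp: close_def)
  next
    case 3
    then show ?thesis using * by (intro exI[of _ "2 ^ k"]) (auto simp: close_def)
  qed
qed

definition sim :: "nat \<Rightarrow> 'r set \<Rightarrow> ('r \<Rightarrow> 'l) \<Rightarrow> 's set \<Rightarrow> ('s \<Rightarrow> 'l) \<Rightarrow> bool" where
  "sim k R f R' f' \<longleftrightarrow> (\<forall>l. close k (card {x \<in> R. f x = l}) (card {x \<in> R'. f' x = l}))"

lemma close_sym: "close k m n \<Longrightarrow> close k n m"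
  by (auto simp: close_def)

lemma sim_sym: "sim k R f R' f' \<Longrightarrow> sim k R' f' R f"
  unfolding sim_def by (simp add: close_sym)

lemma sim_const:
  assumes "2 ^ k \<le> card R" "2 ^ k \<le> card R'"
  shows "sim k R (\<lambda>_. c) R' (\<lambda>_. c)"
  unfolding sim_def
proof
  fix l show "close k (card {x \<in> R. c = l}) (card {x \<in> R'. c = l})"
    using assms by (cases "c = l") (simp_all add: close_def)
qed

text \<open>One round of the game on subsets: \<open>close_split\<close> answers inside each colour
  class separately, and \<open>A'\<close> collects the answers. The new colour keeps the old one as
  its tail.\<close>

lemma sim_refine:
  assumes fin: "finite R" "finite R'" and sim: "sim (Suc k) R f R' f'" and A: "A \<subseteq> R"
  shows "\<exists>A'\<subseteq>R'. sim k R (\<lambda>x. (x \<in> A) # f x) R' (\<lambda>x. (x \<in> A') # f' x)"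
proof -
  let ?split = "\<lambda>l B. B \<subseteq> {x \<in> R'. f' x = l} \<and>
      close k (card {x \<in> A. f x = l}) (card B) \<and>
      close k (card {x \<in> R - A. f x = l}) (card ({x \<in> R'. f' x = l} - B))"
  have "\<exists>B. ?split l B" for l
  proof -
    have sub: "{x \<in> A. f x = l} \<subseteq> {x \<in> R. f x = l}" using A by auto
    then have le: "card {x \<in> A. f x = l} \<le> card {x \<in> R. f x = l}" using fin by (intro card_mono) auto
    have "{x \<in> R - A. f x = l} = {x \<in> R. f x = l} - {x \<in> A. f x = l}" by auto
    then have diff: "card {x \<in> R - A. f x = l} = card {x \<in> R. f x = l} - card {x \<in> A. f x = l}"
      using sub fin A finite_subset[OF A] by (simp add: card_Diff_subset)
    obtain b where b: "b \<le> card {x \<in> R'. f' x = l}" "close k (card {x \<in> A. f x = l}) b"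
      "close k (card {x \<in> R. f x = l} - card {x \<in> A. f x = l}) (card {x \<in> R'. f' x = l} - b)"
      using close_split[OF _ le] sim unfolding sim_def by blast
    obtain B where B: "B \<subseteq> {x \<in> R'. f' x = l}" "card B = b"
      using obtain_subset_with_card_n[OF b(1)] by blast
    have "finite B" using finite_subset[OF B(1)] fin by simp
    then have "card ({x \<in> R'. f' x = l} - B) = card {x \<in> R'. f' x = l} - b"
      using B by (simp add: card_Diff_subset)
    then show ?thesis using B b(2,3) diff by (intro exI[of _ B]) simp
  qed
  then have "\<forall>l. \<exists>B. ?split l B" ..
  from choice[OF this] obtain B where "\<forall>l. ?split l (B l)" ..
  then have B: "\<And>l. B l \<subseteq> {x \<in> R'. f' x = l}"
    "\<And>l. close k (card {x \<in> A. f x = l}) (card (B l))"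
    "\<And>l. close k (card {x \<in> R - A. f x = l}) (card ({x \<in> R'. f' x = l} - B l))" by simp_all
  define A' where "A' = (\<Union>l. B l)"
  \<comment> \<open>The sets \<open>B l\<close> lie in distinct colour classes, so \<open>A'\<close>
    meets the class of \<open>l\<close> exactly in \<open>B l\<close>.\<close>
  have mem: "x \<in> A' \<longleftrightarrow> x \<in> B (f' x)" for x using B(1) by (auto simp: A'_def)
  have "close k (card {x \<in> R. (x \<in> A) # f x = l}) (card {x \<in> R'. (x \<in> A') # f' x = l})" for l
  \<comment> \<open>The empty list is never a refined colour, so both of its classes are
    empty.\<close>
  proof (cases l)
    case (Cons b l)
    have "{x \<in> R. x \<in> A \<and> f x = l} = {x \<in> A. f x = l}"
      "{x \<in> R'. x \<in> A' \<and> f' x = l} = B l"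
      "{x \<in> R. x \<notin> A \<and> f x = l} = {x \<in> R - A. f x = l}"
      "{x \<in> R'. x \<notin> A' \<and> f' x = l} = {x \<in> R'. f' x = l} - B l"
      using A B(1)[of l] mem by auto
    then show ?thesis using B(2,3)[of l] Cons by (cases b) simp_all
  qed (simp add: close_def)
  moreover have "A' \<subseteq> R'" using B(1) by (auto simp: A'_def)
  ultimately show ?thesis unfolding sim_def by blast
qed

lemma close_le:
  assumes "close (Suc k) m n" "j \<le> n" "j \<le> 2"
  shows "j \<le> m"
proof -
  have "2 \<le> (2::nat) ^ Suc k" by simp
  then show ?thesis using assms unfolding close_def by linarith
qed

text \<open>At level \<open>Suc k\<close> the threshold is at least two, so class sizes agree when
  truncated at two. This decides whether a colour occurs and whether it occurs on two distinct
  elements.\<close>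

lemma sim_pair:
  assumes fin: "finite R" "finite R'" and sim: "sim (Suc k) R f R' f'" and x: "x \<in> R'" "y \<in> R'"
  shows "\<exists>u\<in>R. \<exists>v\<in>R. f u = f' x \<and> f v = f' y \<and> (u = v \<longleftrightarrow> x = y)"
proof -
  have le: "j \<le> card {u \<in> R. f u = l}" if "j \<le> card {u \<in> R'. f' u = l}" "j \<le> 2" for j l
    using close_le[OF _ that] sim unfolding sim_def by blast
  have ex: "\<exists>u\<in>R. f u = f' z" if "z \<in> R'" for z
  proof -
    have "z \<in> {u \<in> R'. f' u = f' z}" using that by simp
    then have "0 < card {u \<in> R'. f' u = f' z}" using fin by (intro card_gt_0_iff[THEN iffD2]) auto
    then have "1 \<le> card {u \<in> R. f u = f' z}" by (intro le) auto
    then have "{u \<in> R. f u = f' z} \<noteq> {}" by force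
    then show ?thesis by blast
  qed
  show ?thesis
  proof (cases "x \<noteq> y \<and> f' x = f' y")
    case True
    have "card {x, y} \<le> card {z \<in> R'. f' z = f' x}" using True x fin by (intro card_mono) auto
    then have "2 \<le> card {z \<in> R. f z = f' x}" using True by (intro le) auto
    then obtain u v where "u \<in> {z \<in> R. f z = f' x}" "v \<in> {z \<in> R. f z = f' x}" "u \<noteq> v"
      using ex_two_elements by blast
    then show ?thesis using True by auto
  next
    case False
    then show ?thesis using ex[OF x(1)] ex[OF x(2)] by metis
  qed
qed


section \<open>The game on two boards\<close>

text \<open>\<open>Q\<close> selects pairs of a row colour and a column colour; the same
  \<open>Q\<close> names corresponding sets on both boards.\<close>

definition cells :: "'r set \<Rightarrow> ('r \<Rightarrow> 'l) \<Rightarrow> 'c set \<Rightarrow> ('c \<Rightarrow> 'l) \<Rightarrow> ('l \<Rightarrow> 'l \<Rightarrow> bool) \<Rightarrow> ('r \<times> 'c) set" where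
  "cells R f C g Q = {(x, y). x \<in> R \<and> y \<in> C \<and> Q (f x) (g y)}"

lemma cells_subset: "cells R f C g Q \<subseteq> R \<times> C"
  by (auto simp: cells_def)

text \<open>Counterparts of two rows and two columns at a time, with the same colours and
  equalities, transfer universal statements about two cells from the first board to the
  second.\<close>

locale board_cover =
  fixes R :: "'r set" and f :: "'r \<Rightarrow> 'l" and R' :: "'s set" and f' :: "'s \<Rightarrow> 'l"
    and C :: "'c set" and g :: "'c \<Rightarrow> 'l" and C' :: "'d set" and g' :: "'d \<Rightarrow> 'l"
  assumes rows: "x \<in> R' \<Longrightarrow> y \<in> R' \<Longrightarrow>
      \<exists>u\<in>R. \<exists>v\<in>R. f u = f' x \<and> f v = f' y \<and> (u = v \<longleftrightarrow> x = y)"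
    and cols: "x1 \<in> C' \<Longrightarrow> y1 \<in> C' \<Longrightarrow>
      \<exists>u\<in>C. \<exists>v\<in>C. g u = g' x1 \<and> g v = g' y1 \<and> (u = v \<longleftrightarrow> x1 = y1)"
begin

lemma single_row_cells:
  assumes "single_row (cells R f C g Q)"
  shows "single_row (cells R' f' C' g' Q)"
  unfolding single_row_def
proof (intro allI impI)
  fix x y x' y' assume "(x, y) \<in> cells R' f' C' g' Q" "(x', y') \<in> cells R' f' C' g' Q"
  then show "x = x'"
    using rows[of x x'] cols[of y y'] assms unfolding single_row_def cells_def by force
qed

lemma single_col_cells:
  assumes "single_col (cells R f C g Q)"
  shows "single_col (cells R' f' C' g' Q)"
  unfolding single_col_def
proof (intro allI impI)
  fix x y x' y' assume "(x, y) \<in> cells R' f' C' g' Q" "(x', y') \<in> cells R' f' C' g' Q"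
  then show "y = y'"
    using rows[of x x'] cols[of y y'] assms unfolding single_col_def cells_def by force
qed

lemma all_cells:
  assumes "\<forall>x\<in>R. \<forall>y\<in>C. Q (f x) (g y)"
  shows "\<forall>x\<in>R'. \<forall>y\<in>C'. Q (f' x) (g' y)"
  using assms rows cols by metis

end

locale board_match = board_cover +
  converse: board_cover R' f' R f C' g' C g
begin

lemma single_row_iff: "single_row (cells R f C g Q) \<longleftrightarrow> single_row (cells R' f' C' g' Q)"
  using single_row_cells converse.single_row_cells by blast

lemma single_col_iff: "single_col (cells R f C g Q) \<longleftrightarrow> single_col (cells R' f' C' g' Q)"
  using single_col_cells converse.single_col_cells by blast

lemma all_iff: "(\<forall>x\<in>R. \<forall>y\<in>C. Q (f x) (g y)) \<longleftrightarrow> (\<forall>x\<in>R'. \<forall>y\<in>C'. Q (f' x) (g' y))"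
  using all_cells[of Q] converse.all_cells[of Q] by blast

text \<open>Containing a whole row depends only on which row colours and column colours occur, and
  these are the same on both boards.\<close>

lemma contains_row_iff:
  "(\<exists>x\<in>R. \<forall>y\<in>C. Q (f x) (g y)) \<longleftrightarrow> (\<exists>x\<in>R'. \<forall>y\<in>C'. Q (f' x) (g' y))"
  by (metis rows cols converse.rows converse.cols)

lemma full_row_iff: "full_row R C (cells R f C g Q) \<longleftrightarrow> full_row R' C' (cells R' f' C' g' Q)"
  using single_row_iff[of Q] contains_row_iff[of Q] by (auto simp: full_row_def cells_def)

lemma board_iff: "cells R f C g Q = R \<times> C \<longleftrightarrow> cells R' f' C' g' Q = R' \<times> C'"
  using all_iff[of Q] by (auto simp: cells_def)

lemma eq_cells_iff:
  "cells R f C g Q = cells R f C g Q1 \<longleftrightarrow> cells R' f' C' g' Q = cells R' f' C' g' Q1"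
  using all_iff[of "\<lambda>a b. Q a b \<longleftrightarrow> Q1 a b"] by (auto simp: cells_def set_eq_iff)

lemma disjoint_cells_iff:
  "cells R f C g Q \<inter> cells R f C g Q1 = {} \<longleftrightarrow> cells R' f' C' g' Q \<inter> cells R' f' C' g' Q1 = {}"
  using all_iff[of "\<lambda>a b. \<not> (Q a b \<and> Q1 a b)"] by (auto simp: cells_def set_eq_iff)

lemma rook_carrier_iff:
  "cells R f C g Q \<in> rook_carrier R C \<longleftrightarrow> cells R' f' C' g' Q \<in> rook_carrier R' C'"
  using single_row_iff[of Q] single_col_iff[of Q] full_row_iff[of Q] board_iff[of Q]
    cells_subset[of R f C g Q] cells_subset[of R' f' C' g' Q]
  unfolding rook_carrier_def by blast

lemma rook_J_iff:
  "rook_J R C (cells R f C g Q) (cells R f C g Q1) (cells R f C g Q2) \<longleftrightarrow>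
   rook_J R' C' (cells R' f' C' g' Q) (cells R' f' C' g' Q1) (cells R' f' C' g' Q2)"
proof -
  \<comment> \<open>Unions become disjunctions of selectors, so \<open>E \<union> F\<close> is again
    a set of the form \<open>cells\<close> and the transfer results apply to it.\<close>
  have un: "cells A p B q Q \<union> cells A p B q Q1 = cells A p B q (\<lambda>a b. Q a b \<or> Q1 a b)"
    for A :: "'t set" and p and B :: "'u set" and q
    by (auto simp: cells_def)
  show ?thesis
    unfolding rook_J_def un
    using rook_carrier_iff[of Q] rook_carrier_iff[of Q1] rook_carrier_iff[of Q2]
      disjoint_cells_iff[of Q Q1] eq_cells_iff[of "\<lambda>a b. Q a b \<or> Q1 a b" Q2]
      full_row_iff[of "\<lambda>a b. Q a b \<or> Q1 a b"] board_iff[of Q2]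
    by blast
qed

end

lemma board_match_sim:
  assumes "finite R" "finite R'" "finite C" "finite C'"
    and "sim (Suc k) R f R' f'" "sim (Suc k) C g C' g'"
  shows "board_match R f R' f' C g C' g'"
  using sim_pair[OF assms(1,2,5)] sim_pair[OF assms(2,1) sim_sym[OF assms(5)]]
    sim_pair[OF assms(3,4,6)] sim_pair[OF assms(4,3) sim_sym[OF assms(6)]]
  by unfold_locales

text \<open>The colour of a row or column is the list of its memberships in the sets played so far, so
  every element played is a union of colour classes.\<close>

definition rook_position ::
  "'r set \<Rightarrow> 'c set \<Rightarrow> 's set \<Rightarrow> 'd set \<Rightarrow> nat \<Rightarrow> (('r \<times> 'c) set \<times> ('s \<times> 'd) set) set \<Rightarrow> bool" where
  "rook_position R C R' C' k p \<longleftrightarrow>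
     (\<exists>f f' g g'. sim (Suc k) R f R' f' \<and> sim (Suc k) C g C' g' \<and>
        p \<subseteq> range (\<lambda>Q :: bool list \<Rightarrow> bool list \<Rightarrow> bool. (cells R f C g Q, cells R' f' C' g' Q)))"

lemma rook_position_converse: "rook_position R C R' C' k p \<Longrightarrow> rook_position R' C' R C k (p\<inverse>)"
proof -
  assume "rook_position R C R' C' k p"
  then obtain f f' g g' where sim: "sim (Suc k) R f R' f'" "sim (Suc k) C g C' g'"
    and sub: "p \<subseteq> range (\<lambda>Q :: bool list \<Rightarrow> bool list \<Rightarrow> bool. (cells R f C g Q, cells R' f' C' g' Q))"
    unfolding rook_position_def by blast
  from sub have "p\<inverse> \<subseteq> range (\<lambda>Q. (cells R' f' C' g' Q, cells R f C g Q))" by blast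
  then show ?thesis unfolding rook_position_def using sim_sym[OF sim(1)] sim_sym[OF sim(2)] by blast
qed

lemma rook_position_forward:
  assumes fin: "finite R" "finite R'" "finite C" "finite C'"
    and p: "rook_position R C R' C' (Suc k) p" and E: "E \<in> rook_carrier R C"
  shows "\<exists>E'\<in>rook_carrier R' C'. rook_position R C R' C' k (insert (E, E') p)"
proof -
  obtain f f' g g' where sim: "sim (Suc (Suc k)) R f R' f'" "sim (Suc (Suc k)) C g C' g'"
    and sub: "p \<subseteq> range (\<lambda>Q :: bool list \<Rightarrow> bool list \<Rightarrow> bool. (cells R f C g Q, cells R' f' C' g' Q))"
    using p unfolding rook_position_def by blast
  obtain A B where AB: "A \<subseteq> R" "B \<subseteq> C" "E = A \<times> B" using rook_carrier_rectangle[OF E] .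
  obtain A' where A': "sim (Suc k) R (\<lambda>x. (x \<in> A) # f x) R' (\<lambda>x. (x \<in> A') # f' x)"
    using sim_refine[OF fin(1,2) sim(1) AB(1)] by blast
  obtain B' where B': "sim (Suc k) C (\<lambda>x. (x \<in> B) # g x) C' (\<lambda>x. (x \<in> B') # g' x)"
    using sim_refine[OF fin(3,4) sim(2) AB(2)] by blast
  let ?c = "cells R (\<lambda>x. (x \<in> A) # f x) C (\<lambda>x. (x \<in> B) # g x)"
  let ?c' = "cells R' (\<lambda>x. (x \<in> A') # f' x) C' (\<lambda>x. (x \<in> B') # g' x)"
  interpret board_match R "\<lambda>x. (x \<in> A) # f x" R' "\<lambda>x. (x \<in> A') # f' x"
      C "\<lambda>x. (x \<in> B) # g x" C' "\<lambda>x. (x \<in> B') # g' x"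
    by (rule board_match_sim[OF fin A' B'])
  \<comment> \<open>The heads record membership in \<open>A\<close> and \<open>B\<close>, so
    \<open>?Q\<close> selects the rectangle just played.\<close>
  let ?Q = "\<lambda>a b. hd a \<and> hd b"
  have E_eq: "E = ?c ?Q" using AB by (auto simp: cells_def)
  \<comment> \<open>Elements played earlier are recovered by reading only the tails of the refined
    colours.\<close>
  have "cells R f C g Q = ?c (\<lambda>a b. Q (tl a) (tl b))"
    "cells R' f' C' g' Q = ?c' (\<lambda>a b. Q (tl a) (tl b))" for Q
    by (simp_all add: cells_def)
  then have "p \<subseteq> range (\<lambda>Q. (?c Q, ?c' Q))" using sub by fastforce
  then have "insert (E, ?c' ?Q) p \<subseteq> range (\<lambda>Q. (?c Q, ?c' Q))"
    unfolding E_eq by (intro insert_subsetI rangeI)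
  then have "rook_position R C R' C' k (insert (E, ?c' ?Q) p)"
    unfolding rook_position_def using A' B' by blast
  moreover have "?c' ?Q \<in> rook_carrier R' C'" using E unfolding E_eq rook_carrier_iff .
  ultimately show ?thesis by blast
qed

lemma rook_back_and_forth:
  assumes fin: "finite R" "finite R'" "finite C" "finite C'"
  shows "back_and_forth (rook R C) (rook R' C') (rook_position R C R' C')"
proof
  fix k p E E' F F' H H'
  assume p: "rook_position R C R' C' k p" and EF: "(E, E') \<in> p" "(F, F') \<in> p"
  obtain f f' g g' where sim: "sim (Suc k) R f R' f'" "sim (Suc k) C g C' g'"
    and sub: "p \<subseteq> range (\<lambda>Q :: bool list \<Rightarrow> bool list \<Rightarrow> bool. (cells R f C g Q, cells R' f' C' g' Q))"
    using p unfolding rook_position_def by blast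
  interpret board_match R f R' f' C g C' g' by (rule board_match_sim[OF fin sim])
  show "E = F \<longleftrightarrow> E' = F'"
    using subsetD[OF sub EF(1)] subsetD[OF sub EF(2)] eq_cells_iff by auto
  assume H: "(H, H') \<in> p"
  show "(E, F, H) \<in> Jrel (rook R C) \<longleftrightarrow> (E', F', H') \<in> Jrel (rook R' C')"
    using subsetD[OF sub EF(1)] subsetD[OF sub EF(2)] subsetD[OF sub H] rook_J_iff by auto
next
  fix k p assume "rook_position R C R' C' k p"
  moreover have "({}, {}) = (cells R f C g (\<lambda>_ _. False), cells R' f' C' g' (\<lambda>_ _. False))"
    for f f' g g' :: "_ \<Rightarrow> bool list"
    by (simp add: cells_def)
  ultimately show "rook_position R C R' C' k (insert (zero_elt (rook R C), zero_elt (rook R' C')) p)"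
    unfolding rook_position_def rook_simps by (metis (no_types, lifting) insert_subsetI rangeI)
next
  fix k p E assume "rook_position R C R' C' (Suc k) p" "E \<in> dom (rook R C)"
  then show "\<exists>E'\<in>dom (rook R' C'). rook_position R C R' C' k (insert (E, E') p)"
    using rook_position_forward[OF fin] by simp
next
  \<comment> \<open>The backward move is the forward move with the two boards exchanged.\<close>
  fix k p E' assume p: "rook_position R C R' C' (Suc k) p" and "E' \<in> dom (rook R' C')"
  then obtain E where E: "E \<in> rook_carrier R C" "rook_position R' C' R C k (insert (E', E) (p\<inverse>))"
    using rook_position_forward[OF fin(2,1,4,3) rook_position_converse[OF p]] by auto
  have "(insert (E', E) (p\<inverse>))\<inverse> = insert (E, E') p" by auto
  then show "\<exists>E\<in>dom (rook R C). rook_position R C R' C' k (insert (E, E') p)"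
    using rook_position_converse[OF E(2)] E(1) by auto
qed

lemma rook_models_iff:
  assumes fin: "finite R" "finite R'" "finite C" "finite C'"
    and large: "2 ^ Suc (qdepth \<phi>) \<le> card R" "2 ^ Suc (qdepth \<phi>) \<le> card R'"
      "2 ^ Suc (qdepth \<phi>) \<le> card C" "2 ^ Suc (qdepth \<phi>) \<le> card C'"
    and \<phi>: "sentence \<phi>"
  shows "models (rook R C) \<phi> \<longleftrightarrow> models (rook R' C') \<phi>"
proof -
  interpret back_and_forth "rook R C" "rook R' C'" "rook_position R C R' C'"
    by (rule rook_back_and_forth[OF fin])
  \<comment> \<open>At the start all rows and columns have the colour \<open>[]\<close>, so only the
    sizes of the boards matter.\<close>
  have "rook_position R C R' C' (qdepth \<phi>) {}"
    unfolding rook_position_def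
    using sim_const[OF large(1,2), of "[]"] sim_const[OF large(3,4), of "[]"] by blast
  moreover have "C \<noteq> {}" "C' \<noteq> {}" using large by auto
  ultimately show ?thesis
    using models_iff[where k = "qdepth \<phi>" and \<phi> = \<phi>] \<phi> by (simp add: empty_in_rook_carrier)
qed

section \<open>Two indistinguishable boards inside an arbitrary infinite type\<close>

lemma ex_inj_on_infinite:
  assumes "infinite (UNIV :: 'a set)" "finite A"
  obtains h :: "'b \<Rightarrow> 'a" where "inj_on h A"
proof -
  obtain B :: "'a set" where "finite B" "card B = card A"
    using infinite_arbitrarily_large[OF assms(1)] by blast
  then obtain h where "bij_betw h A B" using finite_same_card_bij[OF assms(2)] by metis
  then show thesis using that by (auto simp: bij_betw_def)
qed

theorem theorem5p5:
  assumes "infinite (UNIV :: 'a set)"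
  shows "\<not> finitely_axiomatisable (representable_structures :: 'a struc set)"
proof
  assume "finitely_axiomatisable (representable_structures :: 'a struc set)"
  then obtain \<Phi> where \<Phi>: "finite \<Phi>" "\<And>\<phi>. \<phi> \<in> \<Phi> \<Longrightarrow> sentence \<phi>"
    and K: "\<And>M :: 'a struc. M \<in> representable_structures \<longleftrightarrow> structure_J0 M \<and> (\<forall>\<phi>\<in>\<Phi>. models M \<phi>)"
    unfolding finitely_axiomatisable_def by blast
  \<comment> \<open>Inserting \<open>0\<close> gives \<open>Max\<close> a nonempty set even when
    there are no axioms.\<close>
  define k where "k = Max (insert 0 (qdepth ` \<Phi>))"
  have k: "qdepth \<phi> \<le> k" if "\<phi> \<in> \<Phi>" for \<phi> using that \<Phi>(1) by (simp add: k_def)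
  \<comment> \<open>One power above \<open>2 ^ k\<close>, as a position with \<open>k\<close> rounds
    left compares sizes at level \<open>Suc k\<close>.\<close>
  define m :: nat where "m = 2 ^ Suc k"
  have m: "2 \<le> m" by (simp add: m_def)
  have large: "2 ^ Suc (qdepth \<phi>) \<le> m" if "\<phi> \<in> \<Phi>" for \<phi>
    unfolding m_def using k[OF that] by (intro power_increasing) auto
  \<comment> \<open>\<open>M\<close> has more rows than columns and \<open>N\<close> two more
    columns than rows, while all four side lengths are at least \<open>m\<close>.\<close>
  define M where "M = rook {..<m + 2} {..<m}"
  define N where "N = rook {..<m} {..<m + 2}"
  have J0: "structure_J0 M" "structure_J0 N"
    using m by (simp_all add: M_def N_def structure_J0_rook lessThan_empty_iff)
  have fin: "finite (dom M)" "finite (dom N)" by (simp_all add: M_def N_def finite_rook_carrier)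
  obtain h :: "(nat \<times> nat) set \<Rightarrow> 'a" where h: "inj_on h (dom M)"
    using ex_inj_on_infinite[OF assms fin(1)] .
  obtain j :: "(nat \<times> nat) set \<Rightarrow> 'a" where j: "inj_on j (dom N)"
    using ex_inj_on_infinite[OF assms fin(2)] .
  have "M \<notin> representable_structures"
    unfolding M_def using m by (intro rook_not_representable) auto
  then have "image_struc h M \<notin> representable_structures"
    using image_struc_representable_iff[OF J0(1) h] by blast
  \<comment> \<open>The copy of \<open>M\<close> is a structure outside the class, so it violates
    some axiom; this axiom holds in the copy of \<open>N\<close> but cannot distinguish the two
    boards.\<close>
  then obtain \<phi> where \<phi>: "\<phi> \<in> \<Phi>" "\<not> models (image_struc h M) \<phi>"
    using K structure_J0_image_struc[OF J0(1)] by blast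
  have "N \<in> representable_structures"
    unfolding N_def using m by (intro rook_representable) auto
  then have "image_struc j N \<in> representable_structures"
    using image_struc_representable_iff[OF J0(2) j] by blast
  then have "models (image_struc j N) \<phi>" using K \<phi>(1) by blast
  then have "models N \<phi>" using models_image_struc[OF J0(2) j \<Phi>(2)[OF \<phi>(1)]] by blast
  moreover have "models M \<phi> \<longleftrightarrow> models N \<phi>"
    unfolding M_def N_def using large[OF \<phi>(1)] \<Phi>(2)[OF \<phi>(1)] by (intro rook_models_iff) auto
  ultimately show False using \<phi>(2) models_image_struc[OF J0(1) h \<Phi>(2)[OF \<phi>(1)]] by blast
qed

end
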